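(* Let $\lambda\ge 1$ be an integer and let $G$ be a graph of order $n$ and minimum degree $\delta$. Let $C$ be a longest cycle in $G$, and let $\overline{p}$ denote the length of a longest path in $G\setminus C$. If $$\delta\ge \frac{n+2}{\lambda+1}+\lambda-2,$$ then either $\overline{p}\le \min\{\lambda-2,\ \delta-\lambda-1\}$ or $\overline{p}\ge \max\{\lambda,\ \delta-\lambda+1\}$.
   Context: All graphs are finite, undirected, without loops or multiple edges; no connectivity assumption is made on $G$. $G\setminus C$ denotes the graph obtained from $G$ by deleting the vertices of $C$. The length of a path is its number of edges (a single vertex is a path of length $0$). If $C$ is a Hamilton cycle (so $G\setminus C$ is empty), then $\overline{p}=-1$. *)

theory Defs
  imports Complex_Main "Graph_Theory.Digraph_Component"
begin

text \<open>
  Simple graphs are the symmetric digraphs of the locale \<^locale>\<open>graph\<close> (finite, loop-free, no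
  parallel arcs): an undirected edge is a pair of opposite arcs. Hence the degree of a vertex is
  its out-degree, and the length of an arc walk is its number of edges.
\<close>

definition min_degree :: "('a, 'b) pre_digraph \<Rightarrow> nat" where
  "min_degree G = Min (out_degree G ` verts G)"

text \<open>
  The constant \<^const>\<open>pre_digraph.cycle\<close> also accepts an edge traversed back and forth, which is
  not a cycle of the undirected graph; the length bound excludes exactly these.
\<close>
definition undirected_cycle :: "('a, 'b) pre_digraph \<Rightarrow> 'b awalk \<Rightarrow> bool" where
  "undirected_cycle G C \<longleftrightarrow> pre_digraph.cycle G C \<and> 3 \<le> length C"

definition longest_cycle :: "('a, 'b) pre_digraph \<Rightarrow> 'b awalk \<Rightarrow> bool" where
  "longest_cycle G C \<longleftrightarrow>
     undirected_cycle G C \<and> (\<forall>D. undirected_cycle G D \<longrightarrow> length D \<le> length C)"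

definition cycle_verts :: "('a, 'b) pre_digraph \<Rightarrow> 'b awalk \<Rightarrow> 'a set" where
  "cycle_verts G C = tail G ` set C"

definition delete_cycle :: "('a, 'b) pre_digraph \<Rightarrow> 'b awalk \<Rightarrow> ('a, 'b) pre_digraph" where
  "delete_cycle G C = G \<restriction> (verts G - cycle_verts G C)"

text \<open>The null graph has no path at all; its longest path has length -1 by convention.\<close>
definition longest_path_length :: "('a, 'b) pre_digraph \<Rightarrow> int" where
  "longest_path_length H =
     (if verts H = {} then -1
      else int (Max {length p | u p v. pre_digraph.apath H u p v}))"

end

(*
  Key inequality: a longest cycle C and the length p of a longest path P of G - C satisfy
  |C| >= (p + 2)(delta - p).  With n >= |C| + p + 1, the hypothesis then gives
  (l - 1 - p)(delta - l - p) > 0, and the two sign patterns are the two alternatives.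

  For the key inequality, choose disjoint paths of G - C starting at the vertices of P (a "comb")
  so that they cover as many vertices as possible and, subject to that, as many of them as possible
  are nontrivial.  Let y_0, ..., y_p be their ends.  By maximality the neighbours of y_i outside C
  lie on the comb; a detour through the comb must not lengthen P, and this bounds the total number
  of such neighbours by p(p + 1).  So the y_i send at least (p + 1)(delta - p) edges to C.
  If y_i and y_j attach to different vertices of C, the comb offers a bypass with at least
  |i - j| + 2 edges, so these vertices are that far apart on C in both directions.  Summing over
  the attachment vertices c, each adjacent to d(c) of the y_i, yields sum (d(c) + 1) <= |C|.
*)

theory Submission
  imports Defs
begin

section \<open>Paths and cycles as vertex lists\<close>

locale sgraph =
  fixes V :: "'a set" and adj :: "'a \<Rightarrow> 'a \<Rightarrow> bool"
  assumes finite_V: "finite V"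
    and adj_in_V: "adj u v \<Longrightarrow> v \<in> V"
    and adj_sym: "adj u v \<Longrightarrow> adj v u"
    and adj_irrefl: "\<not> adj u u"
begin

text \<open>As lists of distinct vertices, paths have one entry more than edges, while cycles have
  as many entries as edges; the closing edge of a cycle is not listed.\<close>

definition vpath :: "'a set \<Rightarrow> 'a list \<Rightarrow> bool" where
  "vpath S xs \<longleftrightarrow> xs \<noteq> [] \<and> distinct xs \<and> successively adj xs \<and> set xs \<subseteq> S"

definition vcycle :: "'a list \<Rightarrow> bool" where
  "vcycle cs \<longleftrightarrow> 3 \<le> length cs \<and> distinct cs \<and> successively adj cs \<and> adj (last cs) (hd cs)"

lemma adj_commute: "adj u v \<longleftrightarrow> adj v u"
  using adj_sym by blast

lemma successively_adj_flip [simp]: "successively (\<lambda>u v. adj v u) xs \<longleftrightarrow> successively adj xs"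
  by (induction xs rule: induct_list012) (auto simp: adj_commute)

lemma vpath_rev [simp]: "vpath S (rev xs) \<longleftrightarrow> vpath S xs"
  by (simp add: vpath_def)

lemma vpath_append_iff:
  "vpath S (xs @ ys) \<longleftrightarrow>
     (xs = [] \<and> vpath S ys) \<or> (ys = [] \<and> vpath S xs) \<or>
     (vpath S xs \<and> vpath S ys \<and> set xs \<inter> set ys = {} \<and> adj (last xs) (hd ys))"
  by (auto simp: vpath_def successively_append_iff)

lemma vpath_append:
  assumes "vpath S xs" "vpath S ys" "set xs \<inter> set ys = {}" "adj (last xs) (hd ys)"
  shows "vpath S (xs @ ys)"
  using assms by (simp add: vpath_append_iff)

lemma vpath_singleton [simp]: "vpath S [z] \<longleftrightarrow> z \<in> S"
  by (simp add: vpath_def)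

lemma vpath_nonempty: "vpath S xs \<Longrightarrow> xs \<noteq> []"
  by (simp add: vpath_def)

lemma vpath_set: "vpath S xs \<Longrightarrow> set xs \<subseteq> S"
  by (simp add: vpath_def)

lemma vpath_length_le:
  assumes "vpath S xs" "finite S"
  shows "length xs \<le> card S"
  using assms by (metis card_mono distinct_card vpath_def)

lemma vpath_appendD1: "vpath S (xs @ ys) \<Longrightarrow> xs \<noteq> [] \<Longrightarrow> vpath S xs"
  and vpath_appendD2: "vpath S (xs @ ys) \<Longrightarrow> ys \<noteq> [] \<Longrightarrow> vpath S ys"
  by (auto simp: vpath_append_iff)

lemma vcycle_iff: "vcycle cs \<longleftrightarrow> 3 \<le> length cs \<and> vpath UNIV cs \<and> adj (last cs) (hd cs)"
  by (auto simp: vcycle_def vpath_def)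

text \<open>\<open>Q\<close> is a bypass outside the cycle from position \<open>k\<close> to
  position \<open>l\<close>. Replacing either of the two arcs between these positions by
  \<open>Q\<close> gives another cycle, so \<open>Q\<close> has at most as many vertices as the
  interior of either arc.\<close>

lemma bypass_length:
  assumes cs: "vcycle cs" "\<And>ds. vcycle ds \<Longrightarrow> length ds \<le> length cs"
    and kl: "k < l" "l < length cs"
    and Q: "vpath S Q" "S \<inter> set cs = {}" "adj (cs ! k) (hd Q)" "adj (last Q) (cs ! l)"
  shows "length Q < l - k" "length Q < length cs - (l - k)"
proof -
  define A where "A = take k cs"
  define B where "B = take (l - Suc k) (drop (Suc k) cs)"
  define D where "D = drop (Suc l) cs"
  define c where "c = cs ! k"
  define d where "d = cs ! l"
  have "drop k cs = c # drop (Suc k) cs" using kl by (simp add: c_def Cons_nth_drop_Suc)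
  moreover have "drop (Suc k) cs = B @ drop l cs"
    using kl append_take_drop_id[of "l - Suc k" "drop (Suc k) cs"] by (simp add: B_def)
  moreover have "drop l cs = d # D" using kl by (simp add: d_def D_def Cons_nth_drop_Suc)
  ultimately have split: "cs = A @ [c] @ B @ [d] @ D"
    using append_take_drop_id[of k cs] by (simp add: A_def)
  have len: "length A = k" "length B = l - Suc k" "length D = length cs - Suc l"
    using kl by (auto simp: A_def B_def D_def)
  have path: "vpath UNIV cs" using cs(1) by (simp add: vcycle_iff)
  have dist: "distinct cs" using cs(1) by (simp add: vcycle_def)
  have cQ: "adj c (hd Q)" and Qd: "adj (last Q) d" using Q(3,4) by (simp_all add: c_def d_def)
  have QU: "vpath UNIV Q" "Q \<noteq> []" using Q(1) by (auto simp: vpath_def)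
  have Qcs: "set Q \<inter> set cs = {}" using Q(1,2) vpath_set by blast
  have Ac: "vpath UNIV (A @ [c])" using path vpath_appendD1[of UNIV "A @ [c]" "B @ [d] @ D"] by (simp add: split)
  have dD: "vpath UNIV (d # D)" using path vpath_appendD2[of UNIV "A @ [c] @ B" "d # D"] by (simp add: split)
  have "vpath UNIV ([c] @ B @ [d] @ D)"
    using path vpath_appendD2[of UNIV A "[c] @ B @ [d] @ D"] by (simp add: split)
  then have cBd: "vpath UNIV (c # B @ [d])"
    using vpath_appendD1[of UNIV "c # B @ [d]" D] by simp
  have "vpath UNIV (Q @ d # D)"
    by (rule vpath_append[OF QU(1) dD]) (use Qd Qcs in \<open>auto simp: split\<close>)
  then have "vpath UNIV ((A @ [c]) @ Q @ d # D)"
    by (rule vpath_append[OF Ac]) (use cQ Qcs QU(2) dist in \<open>auto simp: split\<close>)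
  moreover have "last ((A @ [c]) @ Q @ d # D) = last cs" "hd ((A @ [c]) @ Q @ d # D) = hd cs"
    by (auto simp: split hd_append)
  ultimately have "vcycle ((A @ [c]) @ Q @ d # D)"
    using cs(1) QU(2) by (cases Q) (auto simp: vcycle_iff)
  from cs(2)[OF this] show "length Q < l - k" using len kl by simp
  \<comment> \<open>Now the arc through \<open>D\<close> and \<open>A\<close> is dropped: the arc
    from \<open>c\<close> to \<open>d\<close> is kept and \<open>Q\<close> leads back, traversed in
    reverse.\<close>
  have "vpath UNIV ((c # B @ [d]) @ rev Q)"
    by (rule vpath_append[OF cBd])
      (use Qd Qcs QU in \<open>auto simp: split hd_rev adj_commute\<close>)
  moreover have "last ((c # B @ [d]) @ rev Q) = hd Q" using QU(2) by (simp add: last_rev)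
  ultimately have "vcycle ((c # B @ [d]) @ rev Q)"
    using cQ QU(2) by (cases Q) (auto simp: vcycle_iff adj_commute)
  from cs(2)[OF this] show "length Q < length cs - (l - k)" using len kl by simp
qed

end

section \<open>Counting with gaps between positions\<close>

text \<open>With truncated subtraction, \<open>(i - j) + (j - i)\<close> is the distance of
  \<open>i\<close> and \<open>j\<close>. The distances from \<open>Max A\<close> to
  \<open>Min B\<close> and from \<open>Min A\<close> to \<open>Max B\<close> add up to at least the
  spreads of \<open>A\<close> and \<open>B\<close>, and a set has at most one element more than its
  spread.\<close>

lemma card_add_card_le_gap:
  fixes A B :: "nat set"
  assumes "finite A" "finite B" "A \<noteq> {}" "B \<noteq> {}"
    and gap: "\<And>i j. i \<in> A \<Longrightarrow> j \<in> B \<Longrightarrow> (i - j) + (j - i) + 2 \<le> g"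
  shows "(card A + 1) + (card B + 1) \<le> 2 * g"
proof -
  have "card D \<le> Suc (Max D) - Min D" if "finite D" for D :: "nat set"
  proof -
    have "D \<subseteq> {Min D..Max D}" using that by auto
    then show ?thesis using card_mono[of "{Min D..Max D}" D] by simp
  qed
  then have "card A \<le> Suc (Max A) - Min A" "card B \<le> Suc (Max B) - Min B"
    using assms by auto
  moreover have "Min A \<le> Max A" "Min B \<le> Max B" using assms by auto
  moreover have "(Max A - Min B) + (Min B - Max A) + 2 \<le> g" "(Min A - Max B) + (Max B - Min A) + 2 \<le> g"
    using assms by (auto intro!: gap)
  ultimately show ?thesis by linarith
qed

text \<open>The hypothesis, summed over consecutive elements of \<open>K\<close>, telescopes to
  \<open>2 * (Max K - Min K)\<close> on the right. On the left inner weights occur twice but the two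
  extreme ones only once, hence the correction terms.\<close>

lemma sum_le_spread:
  fixes K :: "nat set" and w :: "nat \<Rightarrow> nat"
  assumes "finite K" "K \<noteq> {}" "\<And>k l. k \<in> K \<Longrightarrow> l \<in> K \<Longrightarrow> k < l \<Longrightarrow> w k + w l \<le> 2 * (l - k)"
  shows "2 * sum w K \<le> 2 * (Max K - Min K) + w (Min K) + w (Max K)"
  using assms
proof (induction K rule: finite_linorder_max_induct)
  case (insert b K)
  show ?case
  proof (cases "K = {}")
    case False
    have "b \<notin> K" using insert.hyps(2) by auto
    have le: "Min K \<le> Max K" using False insert.hyps(1) by auto
    have less: "Max K < b" using False insert.hyps by auto
    have "2 * sum w K \<le> 2 * (Max K - Min K) + w (Min K) + w (Max K)"
      using insert.IH[OF False] insert.prems by simp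
    moreover have "w (Max K) + w b \<le> 2 * (b - Max K)"
      using insert.prems(2)[of "Max K" b] False insert.hyps less by simp
    moreover have "Max (insert b K) = b" "Min (insert b K) = Min K"
      using False insert.hyps less le by simp_all
    ultimately show ?thesis using le less \<open>b \<notin> K\<close> insert.hyps(1) by simp
  qed simp
qed simp

section \<open>Combs, detours and feelers\<close>

text \<open>
  A comb consists of a longest path \<open>x\<^sub>0, \<dots>, x\<^sub>p\<close> of \<open>H\<close>, its spine, and of disjoint paths
  \<open>E i\<close> of \<open>H\<close> that start at \<open>x\<^sub>i\<close> (and may consist of \<open>x\<^sub>i\<close> only).
\<close>

locale comb = sgraph +
  fixes H :: "'a set" and p :: nat and E :: "nat \<Rightarrow> 'a list"
  assumes H_sub: "H \<subseteq> V"
    and longest: "vpath H xs \<Longrightarrow> length xs \<le> Suc p"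
    and tooth: "i \<le> p \<Longrightarrow> vpath H (E i)"
    and disj: "i \<le> p \<Longrightarrow> j \<le> p \<Longrightarrow> i \<noteq> j \<Longrightarrow> set (E i) \<inter> set (E j) = {}"
    and spine: "i < p \<Longrightarrow> adj (hd (E i)) (hd (E (Suc i)))"
begin

abbreviation x :: "nat \<Rightarrow> 'a" where "x i \<equiv> hd (E i)"
abbreviation y :: "nat \<Rightarrow> 'a" where "y i \<equiv> last (E i)"
abbreviation X :: "'a set" where "X \<equiv> x ` {..p}"

lemma E_nonempty: "i \<le> p \<Longrightarrow> E i \<noteq> []"
  using tooth vpath_nonempty by blast

lemma x_in_E: "i \<le> p \<Longrightarrow> x i \<in> set (E i)"
  using E_nonempty by simp

lemma y_in_E: "i \<le> p \<Longrightarrow> y i \<in> set (E i)"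
  using E_nonempty by simp

lemma E_sub_H: "i \<le> p \<Longrightarrow> set (E i) \<subseteq> H"
  using tooth vpath_set by blast

lemma distinct_E: "i \<le> p \<Longrightarrow> distinct (E i)"
  using tooth by (simp add: vpath_def)

lemma X_int_E:
  assumes "j \<le> p" "z \<in> set (E j)" "z \<in> X"
  shows "z = x j"
proof -
  obtain i where "i \<le> p" "z = x i" using assms(3) by auto
  then show ?thesis using disj[of i j] x_in_E[of i] assms by (cases "i = j") auto
qed

lemma inj_x: "inj_on x {..p}"
proof (rule inj_onI)
  fix i j assume "i \<in> {..p}" "j \<in> {..p}" "x i = x j"
  then show "i = j" using disj[of i j] x_in_E[of i] x_in_E[of j] by auto
qed

lemma set_tl_E: "j \<le> p \<Longrightarrow> set (tl (E j)) = set (E j) - {x j}"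
  using distinct_E[of j] E_nonempty[of j] by (cases "E j") auto

lemma set_tl_E_X:
  assumes "j \<le> p"
  shows "set (tl (E j)) \<inter> X = {}"
proof -
  have False if "z \<in> set (tl (E j))" "z \<in> X" for z
  proof -
    have "z \<in> set (E j)" "z \<noteq> x j" using that(1) by (simp_all add: set_tl_E assms)
    then show False using X_int_E[OF assms] that(2) by blast
  qed
  then show ?thesis by blast
qed

lemma segment:
  assumes "i < j" "j \<le> Suc p"
  shows "vpath H (map x [i..<j])"
proof -
  have "inj_on x {i..<j}"
    using inj_x by (rule inj_on_subset) (use assms in auto)
  moreover have "successively adj (map x [i..<j])"
    using assms spine by (auto simp: successively_conv_nth)
  moreover have "x k \<in> H" if "k < j" for k
    using that assms x_in_E[of k] E_sub_H[of k] by auto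
  ultimately show ?thesis
    using assms by (auto simp: vpath_def distinct_map)
qed

lemma hd_segment: "i < j \<Longrightarrow> hd (map x [i..<j]) = x i"
  by (simp add: hd_map)

lemma last_segment: "i < j \<Longrightarrow> last (map x [i..<j]) = x (j - 1)"
  by (simp add: last_map)

text \<open>\<open>Q\<close> hangs off the spine at \<open>x i\<close>. Together with the part of
  the spine before or after \<open>x i\<close> it forms a path, which cannot be longer than the
  spine.\<close>

lemma detour_end:
  assumes "vpath H Q" "set Q \<inter> X = {}" "i \<le> p" "adj (x i) (hd Q)"
  shows "length Q \<le> i" "length Q + i \<le> p"
proof -
  have "vpath H (map x [0..<Suc i] @ Q)"
    using assms by (intro vpath_append segment) (auto simp: last_segment simp del: upt_Suc)
  from longest[OF this] show "length Q + i \<le> p" by simp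
  have "vpath H (rev Q @ map x [i..<Suc p])"
    using assms vpath_nonempty[of H Q]
    by (intro vpath_append segment)
      (auto simp: hd_segment last_rev adj_commute simp del: upt_Suc)
  from longest[OF this] show "length Q \<le> i" using assms by simp
qed

text \<open>Replacing the spine between \<open>x i\<close> and \<open>x j\<close> by
  \<open>Q\<close> must not give a longer path, so \<open>Q\<close> fits into the
  \<open>j - i - 1\<close> vertices it replaces.\<close>

lemma detour:
  assumes "vpath H Q" "set Q \<inter> X = {}" "i < j" "j \<le> p" "adj (x i) (hd Q)" "adj (last Q) (x j)"
  shows "length Q + i < j"
proof -
  define A where "A = map x [0..<Suc i]"
  define B where "B = map x [j..<Suc p]"
  have A: "vpath H A" "last A = x i" "set A \<subseteq> X"
    unfolding A_def using assms
    by (auto intro!: segment simp: last_segment simp del: upt_Suc)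
  have B: "vpath H B" "hd B = x j" "set B \<subseteq> X"
    unfolding B_def using assms
    by (auto intro!: segment simp: hd_segment simp del: upt_Suc)
  have "x k \<noteq> x l" if "k \<le> i" "j \<le> l" "l \<le> p" for k l
    using inj_onD[OF inj_x, of k l] that assms by auto
  then have AB: "set A \<inter> set B = {}"
    unfolding A_def B_def by (auto simp: less_Suc_eq_le simp del: upt_Suc)
  have "vpath H (Q @ B)"
    using assms B by (intro vpath_append) auto
  then have "vpath H (A @ Q @ B)"
    by (rule vpath_append[OF A(1)]) (use assms vpath_nonempty[of H Q] A B AB in auto)
  from longest[OF this] show ?thesis using assms by (simp add: A_def B_def)
qed

text \<open>A way from the spine vertex \<open>x j\<close> to \<open>z\<close> that leaves the spine at once and
  has more than \<open>t\<close> edges.\<close>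

definition feeler :: "'a \<Rightarrow> nat \<Rightarrow> nat \<Rightarrow> bool" where
  "feeler z j t \<longleftrightarrow> j \<le> p \<and> (\<exists>B. vpath H (B @ [z]) \<and> set (B @ [z]) \<inter> X = {} \<and>
     adj (x j) (hd (B @ [z])) \<and> t \<le> length B \<and> set B \<subseteq> set (E j))"

text \<open>The feeler leaves the spine at \<open>x j\<close> with at least \<open>t + 1\<close>
  further vertices, so \<open>detour_end\<close> applies. In particular \<open>j - t\<close> is not
  truncated and is positive.\<close>

lemma feeler_bounds:
  assumes "feeler z j t"
  shows "t < j" "t + j < p"
proof -
  obtain B where B: "j \<le> p" "vpath H (B @ [z])" "set (B @ [z]) \<inter> X = {}"
     "adj (x j) (hd (B @ [z]))" "t \<le> length B"
    using assms unfolding feeler_def by blast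
  show "t < j" "t + j < p"
    using detour_end[OF B(2,3,1,4)] B(5) by auto
qed

text \<open>Two feelers to the same \<open>z\<close> run in different teeth and meet only in
  \<open>z\<close>. One followed by the reverse of the other is a detour with at least
  \<open>s + t + 1\<close> vertices.\<close>

lemma feeler_spread:
  assumes "feeler z i s" "feeler z j t" "i < j"
  shows "i + s + 1 < j - t"
proof -
  obtain B where B: "i \<le> p" "vpath H (B @ [z])" "set (B @ [z]) \<inter> X = {}"
     "adj (x i) (hd (B @ [z]))" "s \<le> length B" "set B \<subseteq> set (E i)"
    using assms(1) unfolding feeler_def by blast
  obtain D where D: "j \<le> p" "vpath H (D @ [z])" "set (D @ [z]) \<inter> X = {}"
     "adj (x j) (hd (D @ [z]))" "t \<le> length D" "set D \<subseteq> set (E j)"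
    using assms(2) unfolding feeler_def by blast
  have disjBD: "set B \<inter> set D = {}"
    using B D disj[of i j] assms(3) by fastforce
  have "vpath H (B @ [z] @ rev D)"
  proof (cases "D = []")
    case False
    then have "vpath H D" "adj (last D) z" "z \<notin> set D"
      using D(2) by (auto simp: vpath_append_iff)
    then have "vpath H ((B @ [z]) @ rev D)"
      using B(2) disjBD False
      by (intro vpath_append[of _ "B @ [z]"]) (auto simp: hd_rev adj_commute)
    then show ?thesis by simp
  qed (use B(2) in simp)
  moreover have "set (B @ [z] @ rev D) \<inter> X = {}" using B(3) D(3) by auto
  moreover have "adj (x i) (hd (B @ [z] @ rev D))" using B(4) by (cases B) auto
  moreover have "adj (last (B @ [z] @ rev D)) (x j)"
    using D(4) by (cases D) (auto simp: adj_commute)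
  ultimately have "length (B @ [z] @ rev D) + i < j"
    using detour assms(3) D(1) by blast
  then show ?thesis using B(5) D(5) by simp
qed

text \<open>Each feeler \<open>(j, t)\<close> reserves the positions \<open>j - t\<close> and \<open>j + t + 1\<close> of the spine.\<close>

lemma card_feelers:
  assumes "\<And>j t. (j, t) \<in> N \<Longrightarrow> feeler z j t"
  shows "finite N" "2 * card N \<le> p"
proof -
  define f where "f = (\<lambda>((j :: nat, t :: nat), b). if b then j + t + 1 else j - t)"
  have inj: "inj_on f (N \<times> UNIV)"
  proof (rule inj_onI)
    fix a a' assume a: "a \<in> N \<times> UNIV" "a' \<in> N \<times> UNIV" "f a = f a'"
    obtain j t b j' t' b' where eq: "a = ((j, t), b)" "a' = ((j', t'), b')"
      by (metis surj_pair)
    have fl: "feeler z j t" "feeler z j' t'" using a eq assms by auto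
    \<comment> \<open>By \<open>feeler_spread\<close> the intervals from \<open>j - t\<close> to
      \<open>j + t + 1\<close> are disjoint for different \<open>j\<close>. For equal
      \<open>j\<close> the lower positions are at most \<open>j\<close> and the upper ones exceed
      it, so \<open>t\<close> and the flag can be read off.\<close>
    have "j = j'"
    proof (rule ccontr)
      assume "j \<noteq> j'"
      then consider "j < j'" | "j' < j" by linarith
      then show False
        using feeler_spread[OF fl] feeler_spread[OF fl(2,1)] a(3)
        by cases (auto simp: eq f_def split: if_splits)
    qed
    with feeler_bounds[OF fl(1)] feeler_bounds[OF fl(2)] a(3) show "a = a'"
      by (auto simp: eq f_def split: if_splits)
  qed
  have img: "f ` (N \<times> UNIV) \<subseteq> {1..p}"
  proof
    fix n assume "n \<in> f ` (N \<times> UNIV)"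
    then obtain j t b where "(j, t) \<in> N" "n = f ((j, t), b)" by auto
    then show "n \<in> {1..p}"
      using feeler_bounds[OF assms, of j t] by (auto simp: f_def)
  qed
  then have "finite (N \<times> (UNIV :: bool set))"
    using inj by (meson finite_atLeastAtMost finite_imageD finite_subset)
  then show "finite N" by (auto simp: finite_cartesian_product_iff)
  have "card (N \<times> (UNIV :: bool set)) \<le> card {1..p}"
    using inj img by (intro card_inj_on_le) auto
  then show "2 * card N \<le> p" by (simp add: card_cartesian_product)
qed

text \<open>A neighbour of the tip at depth \<open>t\<close> of another tooth \<open>j\<close> gives
  a feeler: descend that tooth to depth \<open>t\<close> and step over to \<open>y v\<close>. If the
  neighbour is on the tip's own tooth, the whole tooth serves as the feeler.\<close>

lemma feeler_tip:
  assumes v: "v \<le> p" "2 \<le> length (E v)"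
    and j: "j \<le> p" "t < length (E j)" "adj (y v) (E j ! t)"
  shows "feeler (y v) j t"
proof (cases "j = v")
  case True
  have ne: "tl (E v) \<noteq> []" using v(2) by (cases "E v") auto
  have E: "E v = x v # butlast (tl (E v)) @ [y v]"
    using ne v(2) by (cases "E v") auto
  \<comment> \<open>The last position holds \<open>y v\<close> itself, which is not its own
    neighbour. So \<open>t\<close> is at most \<open>length (E v) - 2\<close>, the number of inner
    vertices of the tooth.\<close>
  have "t \<noteq> length (E v) - 1"
    using j True adj_irrefl v(2) by (metis last_conv_nth list.size(3) not_numeral_le_zero)
  then have t: "t \<le> length (butlast (tl (E v)))" using j True by auto
  have "vpath H ([x v] @ (butlast (tl (E v)) @ [y v]))" using tooth[OF v(1)] E by simp
  then have "vpath H (butlast (tl (E v)) @ [y v])" "adj (x v) (hd (butlast (tl (E v)) @ [y v]))"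
    by (simp_all only: vpath_append_iff, auto)
  moreover have "butlast (tl (E v)) @ [y v] = tl (E v)" using E by (metis list.sel(3))
  ultimately show ?thesis
    using t True v set_tl_E_X[OF v(1)] set_tl_E[OF v(1)] unfolding feeler_def
    by (intro conjI exI[of _ "butlast (tl (E v))"]) (auto dest: in_set_butlastD)
next
  case False
  define B where "B = take t (tl (E j))"
  have E: "take (Suc t) (E j) = x j # B"
    using E_nonempty[OF j(1)] by (cases "E j") (auto simp: B_def)
  have lenB: "length B = t" using j by (simp add: B_def)
  have "vpath H (take (Suc t) (E j) @ drop (Suc t) (E j))" using tooth[OF j(1)] by simp
  then have xB: "vpath H ([x j] @ B)" using E unfolding vpath_append_iff[of _ "take _ _"]
    using E vpath_nonempty by fastforce
  have last: "last (x j # B) = E j ! t"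
    using E j(2) by (metis take_Suc_conv_app_nth last_snoc)
  have yX: "y v \<notin> X"
  proof -
    have "y v \<in> set (tl (E v))" using v(2) by (cases "E v") auto
    then show ?thesis using set_tl_E_X[OF v(1)] by blast
  qed
  have BE: "set B \<subseteq> set (tl (E j))" by (auto simp: B_def dest: in_set_takeD)
  have yj: "y v \<notin> set (E j)" using False v j disj[of v j] y_in_E by blast
  have yH: "y v \<in> H" using v y_in_E E_sub_H by blast
  have "vpath H (([x j] @ B) @ [y v])"
  proof (rule vpath_append)
    show "set ([x j] @ B) \<inter> set [y v] = {}"
      using yj x_in_E[OF j(1)] BE set_tl_E[OF j(1)] by auto
    show "adj (last ([x j] @ B)) (hd [y v])" using last j(3) by (simp add: adj_commute)
  qed (use xB yH in auto)
  then have "vpath H ([x j] @ (B @ [y v]))" by simp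
  then have "vpath H (B @ [y v])" "adj (x j) (hd (B @ [y v]))"
    unfolding vpath_append_iff[of _ "[x j]"] by auto
  then show ?thesis unfolding feeler_def
    using j(1) yX BE set_tl_E_X[OF j(1)] set_tl_E[OF j(1)] lenB
    by (intro conjI exI[of _ B]) auto
qed

text \<open>Climb tooth \<open>i\<close> to the spine, follow the spine, and descend tooth
  \<open>j\<close>. The spine part alone has one vertex more than the distance of \<open>i\<close>
  and \<open>j\<close>.\<close>

lemma tips_connected:
  assumes "i \<le> p" "j \<le> p"
  shows "\<exists>Q. vpath H Q \<and> hd Q = y i \<and> last Q = y j \<and> (i - j) + (j - i) < length Q"
proof -
  have *: "\<exists>Q. vpath H Q \<and> hd Q = y i \<and> last Q = y j \<and> j - i < length Q"
    if ij: "i < j" "j \<le> p" for i j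
  proof -
    have ne: "E i \<noteq> []" "E j \<noteq> []" using ij E_nonempty by auto
    have sub: "set (map x [Suc i..<j]) \<inter> set (E k) = {}" if "k = i \<or> k = j" for k
    proof -
      have "x l \<notin> set (E k)" if "l \<in> {Suc i..<j}" for l
        using disj[of l k] x_in_E[of l] that \<open>k = i \<or> k = j\<close> ij by fastforce
      then show ?thesis by auto
    qed
    have disjij: "set (E i) \<inter> set (E j) = {}" using disj ij by auto
    define M where "M = map x [Suc i..<j]"
    have "vpath H (rev (E i) @ M @ E j)"
    proof (cases "Suc i = j")
      case True
      then have "M = []" by (simp add: M_def)
      then show ?thesis
        using True ij disjij ne spine[of i]
        by (auto intro!: vpath_append tooth simp: last_rev)
    next
      case False
      with ij have lt: "Suc i < j" by simp
      have M: "vpath H M" unfolding M_def by (rule segment) (use ij lt in auto)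
      have subM: "set M \<inter> set (E i) = {}" "set M \<inter> set (E j) = {}"
        unfolding M_def using sub by blast+
      have hdM: "hd M = x (Suc i)" using lt by (simp add: M_def hd_segment)
      have lastM: "last M = x (j - 1)" using lt by (simp add: M_def last_segment)
      have "vpath H (M @ E j)"
        using M ij tooth subM lastM spine[of "j - 1"] by (intro vpath_append) auto
      moreover have "hd (M @ E j) = x (Suc i)" using M hdM vpath_nonempty by simp
      ultimately show ?thesis
        using ij subM disjij spine[of i] ne tooth[of i]
        by (intro vpath_append[of _ "rev (E i)" "M @ E j"]) (auto simp: last_rev)
    qed
    moreover have "hd (rev (E i) @ M @ E j) = y i" using ne by (simp add: hd_append hd_rev)
    moreover have "last (rev (E i) @ M @ E j) = y j" using ne by simp
    moreover have "j - i < length (rev (E i) @ M @ E j)"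
      using ne ij by (cases "E i"; cases "E j") (auto simp: M_def)
    ultimately show ?thesis by blast
  qed
  consider "i = j" | "i < j" | "j < i" by linarith
  then show ?thesis
  proof cases
    case 1
    then show ?thesis
      using assms y_in_E E_sub_H by (intro exI[of _ "[y i]"]) auto
  next
    case 2
    then show ?thesis using *[OF 2 assms(2)] by simp
  next
    case 3
    then obtain Q where "vpath H Q" "hd Q = y j" "last Q = y i" "i - j < length Q"
      using *[OF 3 assms(1)] by blast
    then show ?thesis using 3 vpath_nonempty[of H Q]
      by (intro exI[of _ "rev Q"]) (auto simp: hd_rev last_rev)
  qed
qed

end

section \<open>Neighbours of the tips off the cycle\<close>

definition comb_weight :: "nat \<Rightarrow> (nat \<Rightarrow> 'a list) \<Rightarrow> nat" where
  "comb_weight p E = (\<Sum>i\<le>p. (p + 2) * length (E i) + (if 2 \<le> length (E i) then 1 else 0))"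

text \<open>The factor \<open>p + 2\<close> makes the weight lexicographic: first the number of covered
  vertices counts, then the number of teeth that are longer than a single vertex.\<close>

locale heavy_comb = comb +
  assumes heaviest: "comb V adj H p F \<Longrightarrow> comb_weight p F \<le> comb_weight p E"
begin

text \<open>This produces the competitors for \<open>heaviest\<close>: as the spine is kept, only
  the new teeth need checking.\<close>

lemma comb_same_spine:
  assumes "\<And>i. i \<le> p \<Longrightarrow> vpath H (F i) \<and> hd (F i) = x i"
    and "\<And>i j. i \<le> p \<Longrightarrow> j \<le> p \<Longrightarrow> i < j \<Longrightarrow> set (F i) \<inter> set (F j) = {}"
  shows "comb V adj H p F"
proof unfold_locales
  show "set (F i) \<inter> set (F j) = {}" if "i \<le> p" "j \<le> p" "i \<noteq> j" for i j
    using assms(2)[OF that(1,2)] assms(2)[OF that(2,1)] that(3) by (metis Int_commute nat_neq_iff)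
qed (use H_sub longest assms(1) spine in \<open>auto simp: Suc_leI\<close>)

text \<open>Otherwise tooth \<open>v\<close> could be prolonged by \<open>z\<close>, and the comb
  would cover one vertex more.\<close>

lemma neighbour_of_tip_in_comb:
  assumes "v \<le> p" "z \<in> H" "adj (y v) z"
  shows "\<exists>j\<le>p. z \<in> set (E j)"
proof (rule ccontr)
  assume "\<not> ?thesis"
  then have z: "z \<notin> set (E j)" if "j \<le> p" for j using that by blast
  define F where "F = E(v := E v @ [z])"
  have "comb V adj H p F"
  proof (rule comb_same_spine)
    show "vpath H (F i) \<and> hd (F i) = x i" if "i \<le> p" for i
      using that assms z[of v] tooth[of i] E_nonempty[of v] by (auto simp: F_def intro!: vpath_append)
    show "set (F i) \<inter> set (F j) = {}" if "i \<le> p" "j \<le> p" "i < j" for i j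
      using that z disj[of i j] by (auto simp: F_def)
  qed
  from heaviest[OF this] have "comb_weight p F \<le> comb_weight p E" .
  moreover have "comb_weight p E < comb_weight p F"
    unfolding comb_weight_def by (rule sum_strict_mono_ex1) (use assms in \<open>auto simp: F_def\<close>)
  ultimately show False by simp
qed

text \<open>If \<open>t\<close> were at least 2, tooth \<open>j\<close> could be cut before depth
  \<open>t\<close> and the cut-off part hung on \<open>x v\<close>. The same vertices stay covered,
  but both teeth are now nontrivial, so the weight grows.\<close>

lemma neighbour_of_trivial_tooth:
  assumes v: "v \<le> p" "E v = [x v]" and j: "j \<le> p" "t < length (E j)" "adj (x v) (E j ! t)"
  shows "t \<le> 1"
proof (rule ccontr)
  assume "\<not> t \<le> 1"
  then have t: "2 \<le> t" by simp
  have vj: "v \<noteq> j"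
  proof
    assume "v = j"
    then have "length (E j) = 1" using arg_cong[OF v(2), of length] by simp
    then show False using t j(2) by simp
  qed
  define F where "F = E(v := x v # drop t (E j), j := take t (E j))"
  have xv: "x v \<notin> set (E i)" if "i \<le> p" "i \<noteq> v" for i
    using that disj[of i v] x_in_E[of v] v(1) by auto
  have take_drop: "set (take t (E j)) \<inter> set (drop t (E j)) = {}"
    by (rule set_take_disj_set_drop_if_distinct) (use distinct_E j in auto)
  have "vpath H (take t (E j) @ drop t (E j))" using tooth[OF j(1)] by simp
  then have halves: "vpath H (take t (E j))" "vpath H (drop t (E j))"
    using j(2) t unfolding vpath_append_iff[of _ "take t (E j)"] by auto
  have "comb V adj H p F"
  proof (rule comb_same_spine)
    show "vpath H (F i) \<and> hd (F i) = x i" if i: "i \<le> p" for i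
    proof -
      have "vpath H ([x v] @ drop t (E j))"
        using halves(2) j vj xv[of j] v(1) x_in_E[of v] E_sub_H[of v]
        by (intro vpath_append) (auto simp: hd_drop_conv_nth dest: in_set_dropD)
      then show ?thesis using i halves(1) t tooth[of i] vj by (auto simp: F_def)
    qed
    show "set (F i) \<inter> set (F k) = {}" if "i \<le> p" "k \<le> p" "i < k" for i k
    proof -
      have F: "F v = x v # drop t (E j)" "F j = take t (E j)" "\<And>w. w \<noteq> v \<Longrightarrow> w \<noteq> j \<Longrightarrow> F w = E w"
        using vj by (auto simp: F_def)
      have "x v \<notin> set (take t (E j))" using xv[of j] j(1) vj by (auto dest: in_set_takeD)
      then have vj_disj: "set (F v) \<inter> set (F j) = {}" using take_drop by (auto simp: F)
      have sub: "set (F w) \<subseteq> insert (x v) (set (E j))" if "w = v \<or> w = j" for w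
        using that F set_take_subset[of t "E j"] set_drop_subset[of t "E j"] by auto
      have "set (F w) \<inter> insert (x v) (set (E j)) = {}" if "w \<le> p" "w \<noteq> v" "w \<noteq> j" for w
        using that xv[of w] disj[of w j] j(1) F(3)[of w] by simp
      then have other: "set (F w) \<inter> set (F u) = {}"
        if "w \<le> p" "w \<noteq> v" "w \<noteq> j" "u = v \<or> u = j" for w u
        using that sub by blast
      have rest: "set (F i) \<inter> set (F k) = {}" if "i \<noteq> v" "i \<noteq> j" "k \<noteq> v" "k \<noteq> j"
        using that F(3) disj \<open>i \<le> p\<close> \<open>k \<le> p\<close> \<open>i < k\<close> by simp
      show ?thesis
        using that vj_disj rest other[of i k] other[of k i] by (metis Int_commute nat_neq_iff)
    qed
  qed
  from heaviest[OF this] have "comb_weight p F \<le> comb_weight p E" .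
  moreover have "comb_weight p E < comb_weight p F"
  proof -
    define g :: "'a list \<Rightarrow> nat" where
      "g = (\<lambda>xs. (p + 2) * length xs + (if 2 \<le> length xs then 1 else 0))"
    have split: "(\<Sum>i\<le>p. g (D i)) = g (D v) + (g (D j) + (\<Sum>i\<in>{..p} - {v} - {j}. g (D i)))" for D
      using v j vj by (simp add: sum.remove[of "{..p}" v] sum.remove[of "{..p} - {v}" j])
    have "(\<Sum>i\<in>{..p} - {v} - {j}. g (F i)) = (\<Sum>i\<in>{..p} - {v} - {j}. g (E i))"
      by (intro sum.cong) (auto simp: F_def)
    \<comment> \<open>The lengths of the two teeth have the same sum as before; the gain is the
      extra 1 for tooth \<open>v\<close>, as tooth \<open>j\<close> keeps at least two
      vertices.\<close>
    moreover have "g (E v) + g (E j) < g (F v) + g (F j)"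
    proof -
      have "F v = x v # drop t (E j)" "F j = take t (E j)" using vj by (auto simp: F_def)
      moreover obtain d where "length (E j) = t + d" "d > 0"
        using that[of "length (E j) - t"] j(2) by simp
      moreover have "length (E v) = 1" using arg_cong[OF v(2), of length] by simp
      ultimately show ?thesis using t by (simp add: g_def algebra_simps)
    qed
    ultimately show ?thesis
      unfolding comb_weight_def using split[of E] split[of F] by (simp add: g_def)
  qed
  ultimately show False by simp
qed

definition nb :: "'a \<Rightarrow> 'a set" where
  "nb z = {w \<in> H. adj z w}"

text \<open>Every neighbour in \<open>H\<close> sits at some position \<open>(j, t)\<close> of the
  comb, and each such position yields a feeler ending in the tip; \<open>card_feelers\<close> bounds
  their number.\<close>

lemma card_nb_nontrivial:
  assumes "v \<le> p" "2 \<le> length (E v)"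
  shows "2 * card (nb (y v)) \<le> p"
proof -
  define N where "N = {(j, t). j \<le> p \<and> t < length (E j) \<and> adj (y v) (E j ! t)}"
  have "feeler (y v) j t" if "(j, t) \<in> N" for j t
    using that feeler_tip[OF assms] by (simp add: N_def)
  then have N: "finite N" "2 * card N \<le> p"
    by (rule card_feelers; simp)+
  have "nb (y v) \<subseteq> (\<lambda>(j, t). E j ! t) ` N"
  proof
    fix w assume "w \<in> nb (y v)"
    then obtain j where "adj (y v) w" "j \<le> p" "w \<in> set (E j)"
      using neighbour_of_tip_in_comb[OF assms(1)] by (auto simp: nb_def)
    moreover from this obtain t where "t < length (E j)" "w = E j ! t"
      by (auto simp: in_set_conv_nth)
    ultimately show "w \<in> (\<lambda>(j, t). E j ! t) ` N"
      by (intro image_eqI[of _ _ "(j, t)"]) (auto simp: N_def)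
  qed
  then have "card (nb (y v)) \<le> card N" using N(1) by (rule surj_card_le[rotated])
  then show ?thesis using N(2) by simp
qed

text \<open>A spine neighbour of \<open>E j ! 1\<close> gives a feeler consisting of a single edge,
  that is with \<open>B = []\<close> and \<open>t = 0\<close>.\<close>

lemma card_spine_nb_depth1:
  assumes "j \<le> p" "2 \<le> length (E j)"
  shows "2 * card {v. v \<le> p \<and> adj (x v) (E j ! 1)} \<le> p"
proof -
  let ?A = "{v. v \<le> p \<and> adj (x v) (E j ! 1)}"
  have "E j ! 1 \<in> set (tl (E j))" using assms(2) by (cases "E j") (auto simp: Suc_le_eq)
  then have "E j ! 1 \<in> H" "E j ! 1 \<notin> X"
    using set_tl_E_X[OF assms(1)] set_tl_E[OF assms(1)] E_sub_H[OF assms(1)] by auto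
  then have "feeler (E j ! 1) v 0" if "v \<in> ?A" for v
    using that unfolding feeler_def by (auto intro!: exI[of _ "[]"])
  then have "2 * card (?A \<times> {0::nat}) \<le> p"
    by (intro card_feelers[of _ "E j ! 1"]) auto
  then show ?thesis by (simp add: card_cartesian_product)
qed

text \<open>The tip is \<open>x v\<close> itself, and all its neighbours in \<open>H\<close> have
  depth 0 or 1: other spine vertices, at most \<open>p\<close> of them, and second vertices of
  nontrivial teeth.\<close>

lemma card_nb_trivial:
  assumes "v \<le> p" "\<not> 2 \<le> length (E v)"
  shows "card (nb (y v)) \<le> p + card {j. j \<le> p \<and> 2 \<le> length (E j) \<and> adj (x v) (E j ! 1)}"
    (is "_ \<le> _ + card ?J")
proof -
  have Ev: "E v = [x v]" using assms E_nonempty[of v] by (cases "E v") (auto simp: Suc_le_eq)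
  have "nb (y v) \<subseteq> x ` ({..p} - {v}) \<union> (\<lambda>j. E j ! 1) ` ?J"
  proof
    fix w assume "w \<in> nb (y v)"
    then obtain j where j: "adj (y v) w" "j \<le> p" "w \<in> set (E j)"
      using neighbour_of_tip_in_comb[OF assms(1)] by (auto simp: nb_def)
    have yv: "y v = x v" using Ev by (metis last.simps)
    obtain t where t: "t < length (E j)" "w = E j ! t"
      using j(3) by (auto simp: in_set_conv_nth)
    then have "t \<le> 1" using neighbour_of_trivial_tooth[OF assms(1) Ev j(2)] j(1) yv by auto
    then consider "t = 0" | "t = 1" by linarith
    then show "w \<in> x ` ({..p} - {v}) \<union> (\<lambda>j. E j ! 1) ` ?J"
    proof cases
      case 1
      then have "w = x j" using t E_nonempty[OF j(2)] by (simp add: hd_conv_nth)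
      moreover have "j \<noteq> v" using calculation j(1) yv adj_irrefl by auto
      ultimately show ?thesis using j(2) by auto
    qed (use t j yv in auto)
  qed
  then have "card (nb (y v)) \<le> card (x ` ({..p} - {v}) \<union> (\<lambda>j. E j ! 1) ` ?J)"
    by (rule card_mono[rotated]) auto
  also have "\<dots> \<le> card (x ` ({..p} - {v})) + card ((\<lambda>j. E j ! 1) ` ?J)" by (rule card_Un_le)
  also have "\<dots> \<le> card ({..p} - {v}) + card ?J" by (intro add_mono card_image_le) auto
  finally show ?thesis using assms(1) by simp
qed

text \<open>A trivial tip has at most \<open>p\<close> neighbours at depth 0 and a nontrivial tip at
  most \<open>p / 2\<close> in all. Edges from trivial tips to depth 1 are counted from the other
  side, at most \<open>p / 2\<close> for each nontrivial tooth. So every tooth accounts for at most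
  \<open>p\<close>.\<close>

lemma sum_card_nb: "(\<Sum>i\<le>p. card (nb (y i))) \<le> p * (p + 1)"
proof -
  define T where "T = {i. i \<le> p \<and> \<not> 2 \<le> length (E i)}"
  define N where "N = {i. i \<le> p \<and> 2 \<le> length (E i)}"
  define R where "R = (\<lambda>v j. adj (x v) (E j ! 1))"
  have fin: "finite T" "finite N" by (auto simp: T_def N_def)
  have part: "{..p} = T \<union> N" "T \<inter> N = {}" by (auto simp: T_def N_def)
  have TN: "card T + card N = p + 1"
    using card_Un_disjoint[OF fin part(2)] part(1) by (metis card_atMost Suc_eq_plus1)
  have "(\<Sum>v\<in>T. card {j\<in>N. R v j}) = (\<Sum>v\<in>T. \<Sum>j\<in>N. if R v j then 1 else 0)"
    using fin by (simp add: sum.If_cases Int_def)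
  also have "\<dots> = (\<Sum>j\<in>N. \<Sum>v\<in>T. if R v j then 1 else 0)" by (rule sum.swap)
  also have "\<dots> = (\<Sum>j\<in>N. card {v\<in>T. R v j})"
    using fin by (simp add: sum.If_cases Int_def)
  finally have swap: "(\<Sum>v\<in>T. card {j\<in>N. R v j}) = (\<Sum>j\<in>N. card {v\<in>T. R v j})" .
  have "2 * card {v\<in>T. R v j} \<le> p" if "j \<in> N" for j
  proof -
    have "card {v\<in>T. R v j} \<le> card {v. v \<le> p \<and> adj (x v) (E j ! 1)}"
      by (rule card_mono) (auto simp: T_def R_def)
    then show ?thesis using card_spine_nb_depth1[of j] that by (simp add: N_def)
  qed
  then have "(\<Sum>j\<in>N. 2 * card {v\<in>T. R v j}) \<le> (\<Sum>j\<in>N. p)" by (rule sum_mono)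
  then have 1: "2 * (\<Sum>v\<in>T. card {j\<in>N. R v j}) \<le> card N * p"
    unfolding swap by (simp add: sum_distrib_left)
  have "(\<Sum>i\<in>T. card (nb (y i))) \<le> (\<Sum>i\<in>T. p + card {j\<in>N. R i j})"
    using card_nb_trivial by (intro sum_mono) (simp add: T_def N_def R_def conj_assoc)
  then have 2: "(\<Sum>i\<in>T. card (nb (y i))) \<le> card T * p + (\<Sum>v\<in>T. card {j\<in>N. R v j})"
    by (simp add: sum.distrib)
  have "(\<Sum>i\<in>N. 2 * card (nb (y i))) \<le> (\<Sum>i\<in>N. p)"
    using card_nb_nontrivial by (intro sum_mono) (simp add: N_def)
  then have 3: "2 * (\<Sum>i\<in>N. card (nb (y i))) \<le> card N * p" by (simp add: sum_distrib_left)
  have "(\<Sum>i\<le>p. card (nb (y i))) = (\<Sum>i\<in>T. card (nb (y i))) + (\<Sum>i\<in>N. card (nb (y i)))"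
    unfolding part(1) by (rule sum.union_disjoint[OF fin part(2)])
  also have "\<dots> \<le> card T * p + card N * p" using 1 2 3 by linarith
  also have "\<dots> = p * (p + 1)" using TN by (metis add_mult_distrib mult.commute)
  finally show ?thesis .
qed

end

section \<open>Attachments of the tips to a longest cycle\<close>

locale comb_cycle = heavy_comb +
  fixes cs :: "'a list"
  assumes cycle: "vcycle cs"
    and longest_cycle: "vcycle ds \<Longrightarrow> length ds \<le> length cs"
    and H_eq: "H = V - set cs"
begin

text \<open>Indexed by positions on the cycle; the cardinality is the number d(c) for c =
  \<open>cs ! k\<close>.\<close>

definition attached :: "nat \<Rightarrow> nat set" where
  "attached k = {i. i \<le> p \<and> adj (cs ! k) (y i)}"

lemma finite_attached: "finite (attached k)"
  by (simp add: attached_def)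

lemma card_attached_le: "card (attached k) \<le> p + 1"
  using card_mono[of "{..p}" "attached k"] by (auto simp: attached_def)

text \<open>The path between the two tips from \<open>tips_connected\<close> is a bypass of the
  cycle, bounded in both directions by \<open>bypass_length\<close>.\<close>

lemma attached_gap:
  assumes "k < l" "l < length cs" "i \<in> attached k" "j \<in> attached l"
  shows "(i - j) + (j - i) + 2 \<le> l - k" "(i - j) + (j - i) + 2 \<le> length cs - (l - k)"
proof -
  obtain Q where Q: "vpath H Q" "hd Q = y i" "last Q = y j" "(i - j) + (j - i) < length Q"
    using tips_connected[of i j] assms by (auto simp: attached_def)
  have "adj (cs ! k) (hd Q)" "adj (last Q) (cs ! l)" "H \<inter> set cs = {}"
    using Q assms by (auto simp: attached_def adj_commute H_eq)
  from bypass_length[OF cycle longest_cycle assms(1,2) Q(1) this(3,1,2)] Q(4)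
  show "(i - j) + (j - i) + 2 \<le> l - k" "(i - j) + (j - i) + 2 \<le> length cs - (l - k)"
    by linarith+
qed

text \<open>Needed when there is only one attachment vertex, so that no gap is available. Here the
  path between the extreme attached tips closes up through \<open>cs ! k\<close> to a cycle.\<close>

lemma card_attached_less:
  assumes "k < length cs" "attached k \<noteq> {}"
  shows "card (attached k) + 1 \<le> length cs"
proof -
  have L: "3 \<le> length cs" using cycle by (simp add: vcycle_def)
  define m where "m = Min (attached k)"
  define M where "M = Max (attached k)"
  have mM: "m \<in> attached k" "M \<in> attached k" "m \<le> M"
    using assms(2) finite_attached[of k] by (auto simp: m_def M_def)
  have "attached k \<subseteq> {m..M}" using finite_attached[of k] by (auto simp: m_def M_def)
  then have card: "card (attached k) \<le> Suc M - m" using card_mono[of "{m..M}" "attached k"] by simp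
  show ?thesis
  proof (cases "m = M")
    case False
    with mM have "m < M" by simp
    obtain Q where Q: "vpath H Q" "hd Q = y m" "last Q = y M" "(m - M) + (M - m) < length Q"
      using tips_connected[of m M] mM by (auto simp: attached_def)
    have "cs ! k \<notin> H" using assms(1) by (simp add: H_eq)
    then have "cs ! k \<notin> set Q" using Q(1) vpath_set by blast
    then have "vcycle (cs ! k # Q)"
      using Q mM \<open>m < M\<close> vpath_nonempty[OF Q(1)]
      by (cases Q) (auto simp: vcycle_def vpath_def attached_def adj_commute)
    from longest_cycle[OF this] show ?thesis using Q(4) card by simp
  qed (use L card in simp)
qed

lemma sum_attached_le: "(\<Sum>k | k < length cs \<and> attached k \<noteq> {}. card (attached k) + 1) \<le> length cs"
proof -
  define K where "K = {k. k < length cs \<and> attached k \<noteq> {}}"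
  define w where "w = (\<lambda>k. card (attached k) + 1)"
  have K: "finite K" by (simp add: K_def)
  have "sum w K \<le> length cs"
  proof (cases "K = {}")
    case False
    have in_K: "Min K \<in> K" "Max K \<in> K" "Min K \<le> Max K" using False K by auto
    have "w k + w l \<le> 2 * (l - k)" if "k \<in> K" "l \<in> K" "k < l" for k l
      unfolding w_def using that attached_gap(1)[of k l] finite_attached
      by (intro card_add_card_le_gap) (auto simp: K_def)
    from sum_le_spread[of K w, OF K False this]
    have spread: "2 * sum w K \<le> 2 * (Max K - Min K) + w (Min K) + w (Max K)" by simp
    show ?thesis
    proof (cases "Min K = Max K")
      case True
      then show ?thesis
        using spread card_attached_less[of "Max K"] in_K(2) by (simp add: K_def w_def)
    next
      \<comment> \<open>The arc of the cycle leading from \<open>Max K\<close> around to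
        \<open>Min K\<close> supplies the two end weights that \<open>sum_le_spread\<close> leaves
        over.\<close>
      case False
      then have "Min K < Max K" using in_K(3) by simp
      moreover have "attached (Min K) \<noteq> {}" "attached (Max K) \<noteq> {}" "Max K < length cs"
        using in_K(1,2) by (simp_all add: K_def)
      ultimately have "w (Min K) + w (Max K) \<le> 2 * (length cs - (Max K - Min K))"
        unfolding w_def using finite_attached
        by (intro card_add_card_le_gap attached_gap(2))
      moreover have "Max K < length cs" using in_K(2) by (simp add: K_def)
      ultimately show ?thesis using spread by linarith
    qed
  qed simp
  then show ?thesis by (simp add: K_def w_def)
qed

definition cycle_nb :: "'a \<Rightarrow> 'a set" where
  "cycle_nb z = {c \<in> set cs. adj z c}"

text \<open>The edges between tips and cycle are counted at the cycle vertices. As d is at most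
  \<open>p + 1\<close>, (p + 2) d is at most (p + 1) (d + 1), which turns the sum into that of
  \<open>sum_attached_le\<close>.\<close>

lemma sum_card_cycle_nb: "(p + 2) * (\<Sum>i\<le>p. card (cycle_nb (y i))) \<le> (p + 1) * length cs"
proof -
  have "card (cycle_nb (y i)) = card {k. k < length cs \<and> adj (cs ! k) (y i)}" for i
  proof -
    have "inj_on ((!) cs) {k. k < length cs \<and> adj (cs ! k) (y i)}"
      using cycle by (auto simp: vcycle_def inj_on_def nth_eq_iff_index_eq)
    moreover have "cycle_nb (y i) = (!) cs ` {k. k < length cs \<and> adj (cs ! k) (y i)}"
      by (auto simp: cycle_nb_def in_set_conv_nth adj_commute)
    ultimately show ?thesis by (simp add: card_image)
  qed
  then have "(\<Sum>i\<le>p. card (cycle_nb (y i)))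
      = (\<Sum>i\<le>p. \<Sum>k<length cs. if adj (cs ! k) (y i) then 1 else 0)"
    by (simp add: sum.If_cases Int_def)
  also have "\<dots> = (\<Sum>k<length cs. \<Sum>i\<le>p. if adj (cs ! k) (y i) then 1 else 0)" by (rule sum.swap)
  also have "\<dots> = (\<Sum>k<length cs. card (attached k))"
    by (simp add: sum.If_cases Int_def attached_def)
  also have "\<dots> = (\<Sum>k | k < length cs \<and> attached k \<noteq> {}. card (attached k))"
    by (rule sum.mono_neutral_right) auto
  finally have "(p + 2) * (\<Sum>i\<le>p. card (cycle_nb (y i)))
      = (\<Sum>k | k < length cs \<and> attached k \<noteq> {}. (p + 2) * card (attached k))"
    by (simp add: sum_distrib_left)
  also have "\<dots> \<le> (\<Sum>k | k < length cs \<and> attached k \<noteq> {}. (p + 1) * (card (attached k) + 1))"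
  proof (rule sum_mono)
    show "(p + 2) * card (attached k) \<le> (p + 1) * (card (attached k) + 1)" for k
      using card_attached_le[of k] by simp
  qed
  also have "\<dots> = (p + 1) * (\<Sum>k | k < length cs \<and> attached k \<noteq> {}. card (attached k) + 1)"
    by (simp only: sum_distrib_left)
  also have "\<dots> \<le> (p + 1) * length cs" using sum_attached_le by (rule mult_le_mono2)
  finally show ?thesis .
qed

text \<open>Adding the degrees of all tips and splitting neighbours into those in \<open>H\<close>
  and those on the cycle gives the bound with a common factor \<open>p + 1\<close>, which is
  cancelled. The term \<open>(p + 2) * p\<close> stands on the right to avoid truncated
  subtraction.\<close>

lemma cycle_length_ge:
  assumes "\<And>v. v \<in> V \<Longrightarrow> \<delta> \<le> card {w. adj v w}"
  shows "(p + 2) * \<delta> \<le> (p + 2) * p + length cs"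
proof -
  have "\<delta> \<le> card (nb (y i)) + card (cycle_nb (y i))" if "i \<le> p" for i
  proof -
    have "{w. adj (y i) w} = nb (y i) \<union> cycle_nb (y i)"
    proof -
      have "w \<in> H \<or> w \<in> set cs" if "adj v w" for v w
        using adj_in_V[OF that] unfolding H_eq by simp
      then show ?thesis unfolding nb_def cycle_nb_def by blast
    qed
    then have "card {w. adj (y i) w} \<le> card (nb (y i)) + card (cycle_nb (y i))"
      by (simp add: card_Un_le)
    moreover have "y i \<in> V" using that y_in_E E_sub_H H_sub by blast
    ultimately show ?thesis using assms[of "y i"] by linarith
  qed
  then have "(\<Sum>i\<le>p. \<delta>) \<le> (\<Sum>i\<le>p. card (nb (y i)) + card (cycle_nb (y i)))"
    by (intro sum_mono) simp
  also have "\<dots> \<le> p * (p + 1) + (\<Sum>i\<le>p. card (cycle_nb (y i)))"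
    using sum_card_nb by (simp add: sum.distrib)
  finally have "(p + 2) * ((p + 1) * \<delta>) \<le> (p + 2) * (p * (p + 1) + (\<Sum>i\<le>p. card (cycle_nb (y i))))"
    by (intro mult_le_mono2) simp
  also have "\<dots> \<le> (p + 2) * (p * (p + 1)) + (p + 1) * length cs"
    using sum_card_cycle_nb by (simp add: distrib_left)
  finally have "(p + 1) * ((p + 2) * \<delta>) \<le> (p + 1) * ((p + 2) * p + length cs)"
    by (simp add: algebra_simps)
  then show ?thesis by (simp only: mult_le_cancel1)
qed

end

section \<open>Existence of a heaviest comb\<close>

context sgraph
begin

theorem longest_cycle_length_ge:
  assumes cs: "vcycle cs" "\<And>ds. vcycle ds \<Longrightarrow> length ds \<le> length cs"
    and xs: "vpath (V - set cs) xs" "length xs = Suc p"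
      "\<And>ys. vpath (V - set cs) ys \<Longrightarrow> length ys \<le> Suc p"
    and deg: "\<And>v. v \<in> V \<Longrightarrow> \<delta> \<le> card {w. adj v w}"
  shows "(p + 2) * \<delta> \<le> (p + 2) * p + length cs"
proof -
  define H where "H = V - set cs"
  let ?P = "comb V adj H p"
  \<comment> \<open>A longest path with only trivial teeth is a comb.\<close>
  have init: "?P (\<lambda>i. [xs ! i])"
  proof unfold_locales
    show "vpath H [xs ! i]" if "i \<le> p" for i
      using that xs(1,2) nth_mem[of i xs] by (simp add: vpath_def H_def subset_iff)
    show "set [xs ! i] \<inter> set [xs ! j] = {}" if "i \<le> p" "j \<le> p" "i \<noteq> j" for i j
      using that xs(1,2) by (auto simp: vpath_def nth_eq_iff_index_eq)
    show "adj (hd [xs ! i]) (hd [xs ! Suc i])" if "i < p" for i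
      using that xs(1,2) by (auto simp: vpath_def successively_conv_nth)
  qed (use xs(3) in \<open>auto simp: H_def\<close>)
  \<comment> \<open>Each tooth is a path of \<open>H\<close> and so has at most \<open>p + 1\<close>
    vertices; the bounded weight therefore attains a maximum.\<close>
  have bound: "comb_weight p F < Suc ((p + 1) * ((p + 2) * (p + 1) + 1))" if "?P F" for F
  proof -
    have "length (F i) \<le> Suc p" if "i \<le> p" for i
      using comb.longest[OF \<open>?P F\<close>] comb.tooth[OF \<open>?P F\<close> that] by blast
    then have "comb_weight p F \<le> (\<Sum>i\<le>p. (p + 2) * (p + 1) + 1)"
      unfolding comb_weight_def by (intro sum_mono add_mono mult_le_mono2) auto
    then show ?thesis by simp
  qed
  obtain E where E: "?P E" "\<forall>F. ?P F \<longrightarrow> comb_weight p F \<le> comb_weight p E"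
    using ex_has_greatest_nat[of ?P, OF init, of "comb_weight p"] bound by blast
  interpret comb V adj H p E by (fact E(1))
  interpret comb_cycle V adj H p E cs
    by unfold_locales (use E(2) cs in \<open>auto simp: H_def\<close>)
  show ?thesis using deg by (rule cycle_length_ge)
qed

end

section \<open>Translation between vertex lists and arc walks\<close>

context wf_digraph
begin

lemma successively_awalk_verts:
  assumes "awalk u q v"
  shows "successively (\<lambda>a b. (a, b) \<in> arcs_ends G) (awalk_verts u q)"
  using assms
proof (induction q arbitrary: u)
  case (Cons e q)
  then have e: "e \<in> arcs G" "awalk (head G e) q v" by (auto simp: awalk_Cons_iff)
  then have "hd (awalk_verts (head G e) q) = head G e" by auto
  moreover have "(tail G e, head G e) \<in> arcs_ends G" using e(1) by (rule in_arcs_imp_in_arcs_ends)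
  ultimately show ?case using Cons.IH[OF e(2)] by (simp add: successively_Cons)
qed simp

lemma successively_imp_awalk:
  assumes "xs \<noteq> []" "set xs \<subseteq> verts G" "successively (\<lambda>a b. (a, b) \<in> arcs_ends G) xs"
  shows "\<exists>q. awalk (hd xs) q (last xs) \<and> awalk_verts (hd xs) q = xs"
  using assms
proof (induction xs rule: induct_list012)
  case (2 a)
  then show ?case by (intro exI[of _ "[]"]) (simp add: awalk_Nil_iff)
next
  case (3 a b xs)
  then obtain q where q: "awalk b q (last (b # xs))" "awalk_verts b q = b # xs" by auto
  obtain e where e: "e \<in> arcs G" "tail G e = a" "head G e = b"
    using "3.prems"(3) by (auto simp: arcs_ends_conv)
  show ?case
    by (rule exI[of _ "e # q"]) (use q e in \<open>auto simp: awalk_Cons_iff\<close>)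
qed simp

end

lemma arcs_ends_induce_subgraph:
  "(u, v) \<in> arcs_ends (G \<restriction> S) \<longleftrightarrow> (u, v) \<in> arcs_ends G \<and> u \<in> S \<and> v \<in> S"
  by (auto simp: arcs_ends_conv)

context graph
begin

abbreviation adjacent :: "'a \<Rightarrow> 'a \<Rightarrow> bool" where
  "adjacent u v \<equiv> (u, v) \<in> arcs_ends G"

sublocale sg: sgraph "verts G" adjacent
proof
  show "(u, v) \<in> arcs_ends G \<Longrightarrow> (v, u) \<in> arcs_ends G" for u v
    using sym_arcs by (rule arcs_ends_symmetric)
  show "(u, v) \<in> arcs_ends G \<Longrightarrow> v \<in> verts G" for u v by (auto simp: arcs_ends_conv)
  show "(u, u) \<notin> arcs_ends G" for u using adj_not_same by blast
qed simp

lemma vpath_iff_apath: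
  assumes "S \<subseteq> verts G"
  shows "sg.vpath S xs \<longleftrightarrow>
    (\<exists>u q v. pre_digraph.apath (G \<restriction> S) u q v \<and> pre_digraph.awalk_verts (G \<restriction> S) u q = xs)"
proof -
  interpret S: wf_digraph "G \<restriction> S" by (rule wellformed_induce_subgraph)
  show ?thesis
  proof
    assume xs: "sg.vpath S xs"
    have "successively (\<lambda>a b. (a, b) \<in> arcs_ends (G \<restriction> S)) xs"
      using xs by (auto simp: sg.vpath_def successively_conv_nth arcs_ends_induce_subgraph subset_iff)
    then obtain q where "S.awalk (hd xs) q (last xs)" "S.awalk_verts (hd xs) q = xs"
      using xs S.successively_imp_awalk[of xs] by (auto simp: sg.vpath_def)
    then show "\<exists>u q v. S.apath u q v \<and> S.awalk_verts u q = xs"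
      using xs unfolding S.apath_def sg.vpath_def by metis
  next
    assume "\<exists>u q v. S.apath u q v \<and> S.awalk_verts u q = xs"
    then obtain u q v where q: "S.awalk u q v" "distinct xs" "S.awalk_verts u q = xs"
      by (auto simp: S.apath_def)
    have "successively (\<lambda>a b. (a, b) \<in> arcs_ends (G \<restriction> S)) xs"
      using S.successively_awalk_verts[OF q(1)] q(3) by simp
    then have "successively adjacent xs"
      by (rule successively_mono) (simp add: arcs_ends_induce_subgraph)
    moreover have "set xs \<subseteq> S"
      using q(1,3) unfolding S.awalk_conv by simp
    moreover have "xs \<noteq> []" using q(3) by auto
    ultimately show "sg.vpath S xs" using q(2) by (simp add: sg.vpath_def)
  qed
qed

text \<open>The vertex list of the closed walk is the list of tails followed by the start vertex
  \<open>u\<close> again. Distinctness is known without the first entry and carries over to the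
  tails, since \<open>u\<close> is also the last entry.\<close>

lemma vcycle_tails:
  assumes "undirected_cycle G D"
  shows "sg.vcycle (map (tail G) D)"
proof -
  obtain u where u: "awalk u D u" "distinct (tl (awalk_verts u D))" "D \<noteq> []" "3 \<le> length D"
    using assms by (auto simp: undirected_cycle_def cycle_def)
  have av: "awalk_verts u D = map (tail G) D @ [head G (last D)]"
    using u(3) by (simp add: awalk_verts_conv)
  have hd: "hd (map (tail G) D) = u" using u(1,3) by (cases D) (auto simp: awalk_Cons_iff)
  have last: "head G (last D) = u"
  proof -
    have "last (awalk_verts u D) = u" using u(1) by auto
    then show ?thesis by (simp add: av)
  qed
  have "distinct (tl (map (tail G) D) @ [u])" using u(2,3) by (simp add: av last)
  then have "distinct (map (tail G) D)" using hd u(3) by (cases D) auto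
  moreover have succ: "successively adjacent (map (tail G) D @ [u])"
    using successively_awalk_verts[OF u(1)] by (simp add: av last)
  ultimately show ?thesis
    using u(3,4) hd by (auto simp: sg.vcycle_def successively_append_iff)
qed

lemma vcycle_imp_undirected_cycle:
  assumes "sg.vcycle cs"
  shows "\<exists>D. undirected_cycle G D \<and> length D = length cs"
proof -
  have cs: "3 \<le> length cs" "distinct cs" "successively adjacent cs" "adjacent (last cs) (hd cs)"
    using assms by (auto simp: sg.vcycle_def)
  have ne: "cs \<noteq> []" using cs(1) by auto
  have succ: "successively adjacent (cs @ [hd cs])"
    using cs ne by (simp add: successively_append_iff)
  have "set (cs @ [hd cs]) \<subseteq> verts G"
  proof
    fix v assume "v \<in> set (cs @ [hd cs])"
    then have "v \<in> set cs" using ne by auto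
    then obtain i where i: "i < length cs" "v = cs ! i" by (auto simp: in_set_conv_nth)
    have "adjacent ((cs @ [hd cs]) ! i) ((cs @ [hd cs]) ! Suc i)"
      using succ i(1) by (simp add: successively_conv_nth)
    then show "v \<in> verts G" using i sg.adj_in_V sg.adj_sym by (metis nth_append_left)
  qed
  then obtain D where D: "awalk (hd cs) D (hd cs)" "awalk_verts (hd cs) D = cs @ [hd cs]"
    using successively_imp_awalk[of "cs @ [hd cs]"] succ ne by auto
  have len: "length D = length cs" using length_awalk_verts[of "hd cs" D] D(2) by simp
  have "distinct (tl (cs @ [hd cs]))" using cs(2) ne by (cases cs) auto
  then have "cycle D" using D len ne by (auto simp: cycle_def)
  then show ?thesis using len cs(1) by (auto simp: undirected_cycle_def)
qed

text \<open>Without parallel arcs, an arc leaving \<open>v\<close> is determined by its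
  head.\<close>

lemma card_adjacent_eq_out_degree: "card {w. adjacent v w} = out_degree G v"
proof -
  have "{w. adjacent v w} = head G ` out_arcs G v"
    by (auto simp: arcs_ends_conv out_arcs_def)
  moreover have "inj_on (head G) (out_arcs G v)"
    using no_multi_arcs by (auto simp: inj_on_def out_arcs_def arc_to_ends_def)
  ultimately show ?thesis by (simp add: card_image out_degree_def)
qed

lemma min_degree_le: "v \<in> verts G \<Longrightarrow> min_degree G \<le> card {w. adjacent v w}"
  unfolding card_adjacent_eq_out_degree min_degree_def by simp

lemma longest_path_length_cases:
  assumes "S \<subseteq> verts G" "S \<noteq> {}"
  obtains p xs where "longest_path_length (G \<restriction> S) = int p" "sg.vpath S xs" "length xs = Suc p"
    "\<And>ys. sg.vpath S ys \<Longrightarrow> length ys \<le> Suc p"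
proof -
  interpret S: wf_digraph "G \<restriction> S" by (rule wellformed_induce_subgraph)
  define L where "L = {length q | u q v. S.apath u q v}"
  have finS: "finite S" using assms(1) finite_verts by (rule finite_subset)
  \<comment> \<open>The shift by one is the passage from arcs to vertices.\<close>
  have L: "n \<in> L \<longleftrightarrow> (\<exists>xs. sg.vpath S xs \<and> length xs = Suc n)" for n
    unfolding L_def vpath_iff_apath[OF assms(1)] by (fastforce simp: S.length_awalk_verts)
  have "L \<subseteq> {..card S}"
    using sg.vpath_length_le[OF _ finS] by (fastforce simp: L)
  then have fin: "finite L" by (rule finite_subset) simp
  obtain z where "z \<in> S" using assms(2) by auto
  then have "sg.vpath S [z]" by simp
  then have "0 \<in> L" unfolding L by (intro exI[of _ "[z]"]) simp
  then have "Max L \<in> L" using fin by (intro Max_in) auto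
  then obtain xs where xs: "sg.vpath S xs" "length xs = Suc (Max L)" using L by blast
  have "length ys \<le> Suc (Max L)" if "sg.vpath S ys" for ys
  proof -
    have "length ys = Suc (length ys - 1)" using sg.vpath_nonempty[OF that] by (cases ys) auto
    then have "length ys - 1 \<in> L" using that L by blast
    then have "length ys - 1 \<le> Max L" using fin by simp
    then show ?thesis by simp
  qed
  moreover have "longest_path_length (G \<restriction> S) = int (Max L)"
    using assms(2) by (simp add: longest_path_length_def L_def)
  ultimately show ?thesis using that xs by blast
qed

section \<open>The key inequality for digraphs and the conclusion\<close>

lemma longest_cycle_bounds:
  assumes "longest_cycle G C" and P: "P = longest_path_length (delete_cycle G C)"
  shows "(P + 2) * (int (min_degree G) - P) \<le> int (length C)"
    and "int (length C) + P + 1 \<le> int (card (verts G))"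
proof -
  define cs where "cs = map (tail G) C"
  define S where "S = verts G - set cs"
  have C: "undirected_cycle G C" "\<And>D. undirected_cycle G D \<Longrightarrow> length D \<le> length C"
    using assms(1) by (auto simp: longest_cycle_def)
  have cs: "sg.vcycle cs" "length cs = length C" using vcycle_tails[OF C(1)] by (simp_all add: cs_def)
  have longest: "length ds \<le> length cs" if "sg.vcycle ds" for ds
    using vcycle_imp_undirected_cycle[OF that] C(2) cs(2) by metis
  have del: "delete_cycle G C = G \<restriction> S" by (simp add: delete_cycle_def cycle_verts_def S_def cs_def)
  have "set C \<subseteq> arcs G"
    using C(1) by (auto simp: undirected_cycle_def cycle_def)
  then have sub: "set cs \<subseteq> verts G" by (auto simp: cs_def)
  have card: "card (verts G) = length C + card S"
  proof -
    have "card (set cs) = length C" using cs by (simp add: sg.vcycle_def distinct_card)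
    then show ?thesis
      using sub card_Diff_subset[of "set cs" "verts G"] card_mono[of "verts G" "set cs"]
      by (simp add: S_def)
  qed
  have "(P + 2) * (int (min_degree G) - P) \<le> int (length C) \<and> int (length C) + P + 1 \<le> int (card (verts G))"
  proof (cases "S = {}")
    \<comment> \<open>For a Hamilton cycle the convention gives -1, and the first bound reads
      \<open>min_degree G + 1 \<le> length C\<close>; it holds because a vertex has at most
      \<open>card (verts G) - 1\<close> neighbours.\<close>
    case True
    then have P: "P = -1" by (simp add: P del longest_path_length_def)
    have "3 \<le> length cs" using cs(1) by (simp add: sg.vcycle_def)
    then obtain v where "v \<in> set cs" by (cases cs) auto
    then have v: "v \<in> verts G" using sub by blast
    have "{w. adjacent v w} \<subseteq> verts G - {v}" using sg.adj_in_V sg.adj_irrefl by auto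
    then have "card {w. adjacent v w} \<le> card (verts G - {v})" by (rule card_mono[rotated]) simp
    moreover have "0 < card (verts G)" using v by (auto simp: card_gt_0_iff)
    ultimately have "min_degree G < card (verts G)" using min_degree_le[OF v] v by simp
    then show ?thesis using P card True by simp
  next
    case False
    have "S \<subseteq> verts G" by (simp add: S_def)
    then obtain p xs where p: "longest_path_length (G \<restriction> S) = int p" "sg.vpath S xs" "length xs = Suc p"
      "\<And>ys. sg.vpath S ys \<Longrightarrow> length ys \<le> Suc p"
      using longest_path_length_cases[OF _ False] by blast
    have "(p + 2) * min_degree G \<le> (p + 2) * p + length cs"
      using sg.longest_cycle_length_ge[OF cs(1) longest p(2,3,4)[unfolded S_def] min_degree_le] by blast
    then have "int ((p + 2) * min_degree G) \<le> int ((p + 2) * p + length cs)" by (rule zle_int[THEN iffD2])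
    moreover have "length xs \<le> card S" using p(2) by (rule sg.vpath_length_le) (simp add: S_def)
    ultimately show ?thesis using card p(1,3) cs(2) by (simp add: P del algebra_simps)
  qed
  then show "(P + 2) * (int (min_degree G) - P) \<le> int (length C)"
    and "int (length C) + P + 1 \<le> int (card (verts G))" by blast+
qed

end

theorem theorem2:
  fixes G :: "('a, 'b) pre_digraph" and C :: "'b awalk"
    and l pbar :: int and n \<delta> :: nat
  assumes "l \<ge> 1"
    and "graph G"
    and "n = card (verts G)"
    and "\<delta> = min_degree G"
    and "longest_cycle G C"
    and "pbar = longest_path_length (delete_cycle G C)"
    and "real \<delta> \<ge> (real n + 2) / (real_of_int l + 1) + real_of_int l - 2"
  shows "pbar \<le> min (l - 2) (int \<delta> - l - 1) \<or> pbar \<ge> max l (int \<delta> - l + 1)"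
proof -
  interpret graph G by (fact assms(2))
  have "(pbar + 2) * (int \<delta> - pbar) + pbar + 1 \<le> int n"
    using longest_cycle_bounds[OF assms(5,6)] unfolding assms(3,4) by linarith
  \<comment> \<open>The degree hypothesis is cleared of its denominator, which is positive, and
    moved from the reals to the integers.\<close>
  moreover have "int n + 2 \<le> (l + 1) * (int \<delta> - l + 2)"
  proof -
    have "(real n + 2) / (real_of_int l + 1) \<le> real \<delta> - real_of_int l + 2" using assms(7) by linarith
    then have "real n + 2 \<le> (real \<delta> - real_of_int l + 2) * (real_of_int l + 1)"
      using assms(1) by (simp add: pos_divide_le_eq)
    then have "real_of_int (int n + 2) \<le> real_of_int ((l + 1) * (int \<delta> - l + 2))"
      by (simp add: mult.commute)
    then show ?thesis by (simp only: of_int_le_iff)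
  qed
  \<comment> \<open>The difference of the two sides, after eliminating \<open>n\<close>, is this
    product minus 1, so the product is at least 1. Two positive factors give the first alternative,
    two negative ones the second.\<close>
  ultimately have "0 < (l - 1 - pbar) * (int \<delta> - l - pbar)"
    by (simp add: algebra_simps)
  then show ?thesis by (auto simp: zero_less_mult_iff)
qed

end
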